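(* Let $M\ge 1$ be an integer and let $G=(S,E)$ be a path-complete directed labeled graph on $\{1,\dots,M\}$. Then, for every node $v\in S$, the forward lift $G^v=(S^v,E^v)$ of $G$ with respect to $v$ is path-complete.
   Context: A directed labeled graph on $\{1,\dots,M\}$ is a pair $G=(S,E)$ where $S$ is a finite set of nodes and $E\subseteq S\times S\times\{1,\dots,M\}$; an element $(a,b,i)\in E$ is a directed edge from $a$ to $b$ labeled by $i$ (self-loops and several edges with different labels between the same nodes are allowed). $G$ is path-complete if for every integer $K\ge 1$ and every sequence $(i_1,\dots,i_K)\in\{1,\dots,M\}^K$ there exist nodes $a_1,\dots,a_{K+1}\in S$ such that $(a_k,a_{k+1},i_k)\in E$ for all $k=1,\dots,K$. For $v\in S$, let $\mathrm{Post}(v)=\{w\in S:\exists i,\ (v,w,i)\in E\}$ be the set of out-neighbors of $v$ (possibly containing $v$ itself). The forward lift of $G$ with respect to $v$ is the directed labeled graph $G^v=(S^v,E^v)$ on $\{1,\dots,M\}$ with node set $$S^v=(S\setminus\{v\})\cup\{v^{(w)}:w\in\mathrm{Post}(v)\},$$ where the $v^{(w)}$ are new, pairwise distinct nodes (copies of $v$ indexed by $w$), and edge set $E^v=E_1\cup E_2\cup E_3\cup E_4$, where $$E_1=\{(a,b,i)\in E: a\ne v,\ b\neq v\},$$ $$E_2=\{(a,v^{(w)},i):(a,v,i)\in E,\ w\in\mathrm{Post}(v),\ a\neq v\},$$ $$E_3=\{(v^{(w)},w,i):(v,w,i)\in E,\ w\ne v\},$$ $$E_4=\{(v^{(v)},v^{(w)},i):(v,v,i)\in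 E,\ w\in\mathrm{Post}(v)\}.$$ *)

theory Defs
  imports Main
begin

record 'a lgraph =
  nodes :: "'a set"
  edges :: "('a \<times> 'a \<times> nat) set"

definition labeled_graph :: "nat \<Rightarrow> 'a lgraph \<Rightarrow> bool" where
  "labeled_graph M G \<longleftrightarrow> finite (nodes G) \<and> edges G \<subseteq> nodes G \<times> nodes G \<times> {1..M}"

text \<open>Label sequences and node sequences are functions on \<open>nat\<close>, of which only the values at
  \<open>1..K\<close> and \<open>1..K+1\<close> respectively are constrained.\<close>

definition path_complete :: "nat \<Rightarrow> 'a lgraph \<Rightarrow> bool" where
  "path_complete M G \<longleftrightarrow>
     (\<forall>K\<ge>1. \<forall>i :: nat \<Rightarrow> nat. (\<forall>k\<in>{1..K}. i k \<in> {1..M}) \<longrightarrow>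
       (\<exists>a :: nat \<Rightarrow> 'a. (\<forall>k\<in>{1..K+1}. a k \<in> nodes G) \<and>
          (\<forall>k\<in>{1..K}. (a k, a (k+1), i k) \<in> edges G)))"

definition Post :: "'a lgraph \<Rightarrow> 'a \<Rightarrow> 'a set" where
  "Post G v = {w \<in> nodes G. \<exists>i. (v, w, i) \<in> edges G}"

text \<open>Nodes of the lift with respect to a fixed node \<open>v\<close>: \<open>Old a\<close> is a node \<open>a \<noteq> v\<close> of the original
  graph, and \<open>Copy w\<close> is the new node written \<open>v\<close> with superscript \<open>(w)\<close>. The constructors being
  free makes the copies new and pairwise distinct.\<close>

datatype 'a lift_node = Old 'a | Copy 'a

definition forward_lift :: "'a lgraph \<Rightarrow> 'a \<Rightarrow> 'a lift_node lgraph" where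
  "forward_lift G v = \<lparr>
     nodes = Old ` (nodes G - {v}) \<union> Copy ` Post G v,
     edges =
       {(Old a, Old b, i) | a b i. (a, b, i) \<in> edges G \<and> a \<noteq> v \<and> b \<noteq> v} \<union>
       {(Old a, Copy w, i) | a w i. (a, v, i) \<in> edges G \<and> w \<in> Post G v \<and> a \<noteq> v} \<union>
       {(Copy w, Old w, i) | w i. (v, w, i) \<in> edges G \<and> w \<noteq> v} \<union>
       {(Copy v, Copy w, i) | w i. (v, v, i) \<in> edges G \<and> w \<in> Post G v}\<rparr>"

lemma labeled_graph_forward_lift:
  assumes "labeled_graph M G"
  shows "labeled_graph M (forward_lift G v)"
proof -
  have "finite (Post G v)"
    using assms by (simp add: labeled_graph_def Post_def)
  then show ?thesis
    using assms unfolding labeled_graph_def forward_lift_def by (auto simp: Post_def)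
qed

end

theory Submission
  imports Defs
begin

text \<open>Extend the word by one letter and read the longer word in \<open>G\<close>. A visit of the resulting walk
  to \<open>v\<close> is lifted to the copy of \<open>v\<close> indexed by the next node of the walk; the additional letter
  provides the next node at the last position.\<close>

theorem theorem2:
  fixes M :: nat and G :: "'a lgraph" and v :: 'a
  assumes "M \<ge> 1"
    and "labeled_graph M G"
    and "path_complete M G"
    and "v \<in> nodes G"
  shows "path_complete M (forward_lift G v)"
  unfolding path_complete_def
proof (intro allI impI)
  fix K :: nat and i :: "nat \<Rightarrow> nat"
  assume K: "K \<ge> 1" and i: "\<forall>k\<in>{1..K}. i k \<in> {1..M}"
  \<comment> \<open>Any label would do at \<open>K + 1\<close>; 1 is admissible because
    \<open>M \<ge> 1\<close>.\<close>
  define j where "j = i(K + 1 := 1)"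
  have "\<forall>k\<in>{1..K+1}. j k \<in> {1..M}"
    using i \<open>M \<ge> 1\<close> by (auto simp: j_def)
  then obtain a where nodes: "\<And>k. k \<in> {1..K+1} \<Longrightarrow> a k \<in> nodes G \<and> a (k+1) \<in> nodes G"
    and walk: "\<And>k. k \<in> {1..K+1} \<Longrightarrow> (a k, a (k+1), j k) \<in> edges G"
    using \<open>path_complete M G\<close>[unfolded path_complete_def, rule_format, of "K+1" j] by fastforce
  have post: "a (k+1) \<in> Post G v" if "k \<in> {1..K+1}" "a k = v" for k
    using nodes[OF that(1)] walk[OF that(1)] that(2) by (auto simp: Post_def)
  define b where "b k = (if a k = v then Copy (a (k+1)) else Old (a k))" for k
  have "b k \<in> nodes (forward_lift G v)" if "k \<in> {1..K+1}" for k
    using nodes[OF that] post[OF that] by (auto simp: b_def forward_lift_def)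
  moreover have "(b k, b (k+1), i k) \<in> edges (forward_lift G v)" if k: "k \<in> {1..K}" for k
  proof -
    have "(a k, a (k+1), i k) \<in> edges G"
      using walk[of k] k by (auto simp: j_def)
    \<comment> \<open>Edges into a copy need its index in \<open>Post G v\<close>. For
      \<open>k = K\<close> this uses the step of the walk along the added letter.\<close>
    moreover have "a (k+1) = v \<Longrightarrow> a (k+1+1) \<in> Post G v"
      using post[of "k+1"] k by simp
    \<comment> \<open>The four cases of \<open>a k = v\<close> and \<open>a (k+1) = v\<close> match
      the four edge sets of the lift; if both hold, \<open>b k\<close> is \<open>Copy v\<close>, the
      only copy with edges to copies.\<close>
    ultimately show ?thesis
      by (auto simp: b_def forward_lift_def)
  qed
  ultimately show "\<exists>b. (\<forall>k\<in>{1..K+1}. b k \<in> nodes (forward_lift G v)) \<and>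
      (\<forall>k\<in>{1..K}. (b k, b (k+1), i k) \<in> edges (forward_lift G v))"
    by blast
qed

end
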